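(* There exist oblivious message adversaries with exponential consensus time complexity in spite of a constant iteration complexity $\mathrm{TD}$ of the decision procedure. Precisely: there exist constants $a>1$, $K$ and $n_0$ such that for every $n\ge n_0$ there is a set $\mathbf{D}$ of rooted communication graphs on $n$ processes such that $\mathrm{TD}(\mathbf{D})\le K$, consensus is solvable under $\mathbf{D}$, and for every consensus algorithm correct under $\mathbf{D}$ there is a run in which some process has not decided by the end of round $\lfloor a^n\rfloor$.
   Context: **Model.** $\Pi=\{p_1,\dots,p_n\}$ is a set of $n$ processes. A communication graph is a directed graph on $\Pi$ containing all self-loops; $\mathrm{In}_G(p)=\{q:(q,p)\in E(G)\}$. An oblivious message adversary is given by a nonempty set $\mathbf{D}$ of communication graphs; its admissible infinite communication patterns are all sequences $\sigma=(\sigma(1),\sigma(2),\dots)\in\mathbf{D}^\omega$ with every $\sigma(r)\in\mathbf{D}$. Given inputs $(x_p)_{p\in\Pi}$, views are defined by $\mathrm{view}_\sigma(p,0)=\{(p,0,x_p)\}$ and, for $r\ge1$, $\mathrm{view}_\sigma(p,r)=(p,r,\{\mathrm{view}_\sigma(q,r-1):(q,p)\in\sigma(r)\})$. **Consensus.** Each process $p$ has an input $x_p$ from a finite domain $V$ with $|V|\ge2$; all input assignments are possible. A (deterministic, full-information) consensus algorithm is a family of decision functions $\Delta_p$ mapping each possible view of $p$ to $V\cup\{\bot\}$ such that if $\Delta_p(\mathrm{view}_\sigma(p,r))\ne\bot$ then $\Delta_p(\mathrm{view}_\sigma(p,r'))=\Delta_p(\mathrm{view}_\sigma(p,r))$ for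 all $r'\ge r$. A run is determined by an input assignment and some $\sigma\in\mathbf{D}^\omega$; $p$ has decided $v\neq\bot$ by (the end of) round $r$ if $\Delta_p(\mathrm{view}_\sigma(p,r))=v$. The algorithm is correct under $\mathbf{D}$ if in every run every process eventually decides (termination), no two processes decide differently (agreement), and every decided value is the input of some process (validity). Consensus is solvable under $\mathbf{D}$ if a correct algorithm exists. **Roots.** A root component of a graph is a strongly connected component with no incoming edge from outside. A graph $G$ is rooted if it has exactly one root component, whose node set is $\mathrm{Root}(G)$. A set $\mathbf{S}$ of rooted communication graphs is root-compatible if $\bigcap_{G\in\mathbf{S}}\mathrm{Root}(G)\ne\emptyset$. **Decision procedure.** $I(\mathbf{D})$ is the undirected graph with node set $\mathbf{D}$ in which $G,H$ are joined by an edge $e$ iff its label $\ell(e)=\{p\in\Pi:\mathrm{In}_G(p)=\mathrm{In}_H(p)\}$ is nonempty. Put $\mathcal{N}_1=I(\mathbf{D})$. For $i\ge2$, $\mathcal{N}_i$ has node set $\mathbf{D}$, and its edges are those edges $e$ of $\mathcal{N}_{i-1}$ for which the connected component of $\mathcal{N}_{i-1}$ containing $e$ contains a node $G$ with $\mathrm{Root}(G)\subseteq\ell(e)$. The decision procedure computes $\mathcal{N}_2,\mathcal{N}_3,\dots$ and stops at the first index $i\ge2$ such that $\mathcal{N}_i=\mathcal{N}_{i-1}$ or all connected components of $\mathcal{N}_i$ are root-compatible; this index is $\mathrm{TD}(\mathbf{D})$. *)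

theory Defs
  imports Complex_Main "HOL-Library.FSet"
begin

text \<open>
  The processes are the numbers \<open>0, \<dots>, n - 1\<close>. A graph is given by its edge set only;
  its node set is always \<open>{..<n}\<close>.
\<close>

type_synonym graph = "(nat \<times> nat) set"

definition comm_graph :: "nat \<Rightarrow> graph \<Rightarrow> bool" where
  "comm_graph n G \<longleftrightarrow> G \<subseteq> {..<n} \<times> {..<n} \<and> (\<forall>p<n. (p, p) \<in> G)"

definition In_nbrs :: "graph \<Rightarrow> nat \<Rightarrow> nat set" where
  "In_nbrs G p = {q. (q, p) \<in> G}"

definition oblivious_adversary :: "nat \<Rightarrow> graph set \<Rightarrow> bool" where
  "oblivious_adversary n D \<longleftrightarrow> D \<noteq> {} \<and> (\<forall>G\<in>D. comm_graph n G)"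

text \<open>Communication patterns are indexed from round 1; the value at index 0 is irrelevant.\<close>

definition admissible :: "graph set \<Rightarrow> (nat \<Rightarrow> graph) \<Rightarrow> bool" where
  "admissible D \<sigma> \<longleftrightarrow> (\<forall>r\<ge>1. \<sigma> r \<in> D)"

text \<open>
  \<open>Init p v\<close> stands for the round-0 view \<open>{(p, 0, v)}\<close>, and \<open>Recv p r S\<close> for the triple
  \<open>(p, r, S)\<close>. Received views are collected in finite sets so that the recursive datatype is
  admissible; for communication graphs the in-neighbourhoods are finite, hence \<open>Abs_fset\<close>
  is applied to a finite set.
\<close>

datatype 'v local_view = Init nat 'v | Recv nat nat "'v local_view fset"

primrec view :: "(nat \<Rightarrow> graph) \<Rightarrow> (nat \<Rightarrow> 'v) \<Rightarrow> nat \<Rightarrow> nat \<Rightarrow> 'v local_view" where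
  "view \<sigma> x 0 = (\<lambda>p. Init p (x p))"
| "view \<sigma> x (Suc r) =
     (\<lambda>p. Recv p (Suc r) (Abs_fset ((\<lambda>q. view \<sigma> x r q) ` In_nbrs (\<sigma> (Suc r)) p)))"

text \<open>A run is an input assignment \<open>x\<close> together with a pattern \<open>\<sigma>\<close>.\<close>

definition is_run ::
    "nat \<Rightarrow> 'v set \<Rightarrow> graph set \<Rightarrow> (nat \<Rightarrow> 'v) \<Rightarrow> (nat \<Rightarrow> graph) \<Rightarrow> bool" where
  "is_run n V D x \<sigma> \<longleftrightarrow> (\<forall>p<n. x p \<in> V) \<and> admissible D \<sigma>"

text \<open>
  A family \<open>\<Delta>\<close> of decision functions; \<open>None\<close> is the undecided value. Only its values on
  views that occur in runs matter.
\<close>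

definition consensus_algorithm ::
    "nat \<Rightarrow> 'v set \<Rightarrow> graph set \<Rightarrow> (nat \<Rightarrow> 'v local_view \<Rightarrow> 'v option) \<Rightarrow> bool" where
  "consensus_algorithm n V D \<Delta> \<longleftrightarrow>
     (\<forall>x \<sigma>. is_run n V D x \<sigma> \<longrightarrow> (\<forall>p<n. \<forall>r.
        \<Delta> p (view \<sigma> x r p) \<in> insert None (Some ` V) \<and>
        (\<Delta> p (view \<sigma> x r p) \<noteq> None \<longrightarrow>
          (\<forall>r'\<ge>r. \<Delta> p (view \<sigma> x r' p) = \<Delta> p (view \<sigma> x r p)))))"

definition decided_by ::
    "(nat \<Rightarrow> 'v local_view \<Rightarrow> 'v option) \<Rightarrow> (nat \<Rightarrow> 'v) \<Rightarrow> (nat \<Rightarrow> graph) \<Rightarrow> nat \<Rightarrow> nat \<Rightarrow> 'v \<Rightarrow> bool" where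
  "decided_by \<Delta> x \<sigma> p r v \<longleftrightarrow> \<Delta> p (view \<sigma> x r p) = Some v"

definition correct_under ::
    "nat \<Rightarrow> 'v set \<Rightarrow> graph set \<Rightarrow> (nat \<Rightarrow> 'v local_view \<Rightarrow> 'v option) \<Rightarrow> bool" where
  "correct_under n V D \<Delta> \<longleftrightarrow>
     consensus_algorithm n V D \<Delta> \<and>
     (\<forall>x \<sigma>. is_run n V D x \<sigma> \<longrightarrow>
        (\<forall>p<n. \<exists>r v. decided_by \<Delta> x \<sigma> p r v) \<and>
        (\<forall>p<n. \<forall>q<n. \<forall>r s v w.
           decided_by \<Delta> x \<sigma> p r v \<longrightarrow> decided_by \<Delta> x \<sigma> q s w \<longrightarrow> v = w) \<and>
        (\<forall>p<n. \<forall>r v. decided_by \<Delta> x \<sigma> p r v \<longrightarrow> (\<exists>q<n. v = x q)))"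

definition consensus_solvable :: "nat \<Rightarrow> 'v set \<Rightarrow> graph set \<Rightarrow> bool" where
  "consensus_solvable n V D \<longleftrightarrow> (\<exists>\<Delta>. correct_under n V D \<Delta>)"

definition strong_components :: "nat \<Rightarrow> graph \<Rightarrow> nat set set" where
  "strong_components n G =
     {..<n} // {(p, q) \<in> {..<n} \<times> {..<n}. (p, q) \<in> G\<^sup>* \<and> (q, p) \<in> G\<^sup>*}"

definition root_components :: "nat \<Rightarrow> graph \<Rightarrow> nat set set" where
  "root_components n G =
     {C \<in> strong_components n G. \<not> (\<exists>p q. (q, p) \<in> G \<and> p \<in> C \<and> q \<notin> C)}"

definition rooted :: "nat \<Rightarrow> graph \<Rightarrow> bool" where
  "rooted n G \<longleftrightarrow> (\<exists>!C. C \<in> root_components n G)"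

definition Root :: "nat \<Rightarrow> graph \<Rightarrow> nat set" where
  "Root n G = (THE C. C \<in> root_components n G)"

text \<open>Only meaningful for nonempty sets of rooted graphs.\<close>

definition root_compatible :: "nat \<Rightarrow> graph set \<Rightarrow> bool" where
  "root_compatible n S \<longleftrightarrow> (\<Inter>G\<in>S. Root n G) \<noteq> {}"

text \<open>
  An undirected graph with node set \<open>D\<close> is represented by its edge set, a symmetric irreflexive
  relation on \<open>D\<close>. Loops are left out; they would carry the label \<open>{..<n}\<close>, so they would never
  be removed and would not influence the connected components.
\<close>

definition edge_label :: "nat \<Rightarrow> graph \<Rightarrow> graph \<Rightarrow> nat set" where
  "edge_label n G H = {p \<in> {..<n}. In_nbrs G p = In_nbrs H p}"

definition indist_graph :: "nat \<Rightarrow> graph set \<Rightarrow> (graph \<times> graph) set" where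
  "indist_graph n D = {(G, H) \<in> D \<times> D. G \<noteq> H \<and> edge_label n G H \<noteq> {}}"

definition component_of :: "(graph \<times> graph) set \<Rightarrow> graph \<Rightarrow> graph set" where
  "component_of E G = E\<^sup>* `` {G}"

definition refine :: "nat \<Rightarrow> (graph \<times> graph) set \<Rightarrow> (graph \<times> graph) set" where
  "refine n E = {(G, H) \<in> E. \<exists>F \<in> component_of E G. Root n F \<subseteq> edge_label n G H}"

text \<open>The iteration starts at index 1; index 0 is not used.\<close>

definition iterate_graph :: "nat \<Rightarrow> graph set \<Rightarrow> nat \<Rightarrow> (graph \<times> graph) set" where
  "iterate_graph n D i = (refine n ^^ (i - 1)) (indist_graph n D)"

text \<open>
  For an oblivious message adversary \<open>D\<close> is finite and the edge sets decrease, so the minimum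
  is attained.
\<close>

definition TD :: "nat \<Rightarrow> graph set \<Rightarrow> nat" where
  "TD n D = (LEAST i. i \<ge> 2 \<and>
     (iterate_graph n D i = iterate_graph n D (i - 1) \<or>
      (\<forall>G\<in>D. root_compatible n (component_of (iterate_graph n D i) G))))"

end

theory Submission
  imports Defs
begin

text \<open>
  The adversary consists of exponentially many blocks, one for each member \<open>J\<close> of an
  antichain of sets, and every process recognises the block of each round at once. Within a
  block, every edge of the indistinguishability graph has a label that contains no root of a graph
  of that block, so \<open>\<N>\<^sub>2\<close> has no edges. As soon as a block is used for the second time,
  everyone knows which graph was chosen at its first use (up to an irrelevant ambiguity), and this
  makes consensus solvable.

  A run need not repeat a block for exponentially many rounds, however. The processes have two
  colours. The graph \<open>mid\<close> of a block \<open>J\<close> mixes the colours, whereas in \<open>side c J l\<close>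
  colour \<open>c\<close> hears only from itself, with root \<open>{u c l} \<union> w c ` J\<close>. Exchanging
  \<open>mid\<close> and \<open>side c J l\<close> is noticed by colour \<open>c\<close> and by the processes
  \<open>u (\<not> c) i\<close> with \<open>i \<in> J\<close>. It remains hidden from the rest of colour \<open>\<not> c\<close> if
  each later block \<open>J'\<close> uses \<open>side (\<not> c) J' l'\<close> with \<open>l' \<in> J' - J\<close>. Hence, by
  induction from the last round backwards, all choices of graphs from a sequence of distinct blocks
  lead to the same decision. Since these choices include hiding the inputs of either colour, the
  processes cannot have decided yet.
\<close>

section \<open>Equality of views\<close>

lemma view_eq_imp_same:
  "view \<sigma> x r p = view \<sigma>' x' r' p' \<Longrightarrow> p = p' \<and> r = r'"
  by (cases r; cases r') auto

text \<open>A view names its owner, so a set of received views reveals who sent which. Finiteness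
  makes \<open>Abs_fset\<close> injective here.\<close>

lemma view_Suc_eq_iff:
  assumes "finite (In_nbrs (\<sigma> (Suc r)) p)" "finite (In_nbrs (\<sigma>' (Suc r)) p)"
  shows "view \<sigma> x (Suc r) p = view \<sigma>' x' (Suc r) p \<longleftrightarrow>
    In_nbrs (\<sigma> (Suc r)) p = In_nbrs (\<sigma>' (Suc r)) p \<and>
    (\<forall>q\<in>In_nbrs (\<sigma> (Suc r)) p. view \<sigma> x r q = view \<sigma>' x' r q)"
    (is "?L \<longleftrightarrow> ?A = ?B \<and> _")
proof -
  have "?L \<longleftrightarrow> view \<sigma> x r ` ?A = view \<sigma>' x' r ` ?B"
    using assms by (simp add: Abs_fset_inject)
  also have "\<dots> \<longleftrightarrow> ?A = ?B \<and> (\<forall>q\<in>?A. view \<sigma> x r q = view \<sigma>' x' r q)"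
  proof
    assume eq: "view \<sigma> x r ` ?A = view \<sigma>' x' r ` ?B"
    have 1: "q \<in> ?B \<and> view \<sigma> x r q = view \<sigma>' x' r q" if "q \<in> ?A" for q
    proof -
      have "view \<sigma> x r q \<in> view \<sigma>' x' r ` ?B" unfolding eq[symmetric] using that by (rule imageI)
      then obtain q' where q': "q' \<in> ?B" "view \<sigma> x r q = view \<sigma>' x' r q'" by (elim imageE)
      moreover have "q = q'" using view_eq_imp_same[OF q'(2)] by simp
      ultimately show ?thesis by simp
    qed
    have 2: "q \<in> ?A" if "q \<in> ?B" for q
    proof -
      have "view \<sigma>' x' r q \<in> view \<sigma> x r ` ?A" unfolding eq using that by (rule imageI)
      then obtain q' where q': "q' \<in> ?A" "view \<sigma>' x' r q = view \<sigma> x r q'" by (elim imageE)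
      moreover have "q = q'" using view_eq_imp_same[OF q'(2)] by simp
      ultimately show ?thesis by simp
    qed
    from 1 2 show "?A = ?B \<and> (\<forall>q\<in>?A. view \<sigma> x r q = view \<sigma>' x' r q)" by blast
  qed auto
  finally show ?thesis .
qed

text \<open>The tool for indistinguishability: \<open>K t\<close> collects processes whose views
  agree after round \<open>t\<close>, and members of \<open>K (Suc t)\<close> hear only from
  \<open>K t\<close>.\<close>

lemma view_eqI:
  assumes "\<And>p. p \<in> K 0 \<Longrightarrow> x p = x' p"
    and "\<And>t p. t < r \<Longrightarrow> p \<in> K (Suc t) \<Longrightarrow>
      In_nbrs (\<sigma> (Suc t)) p = In_nbrs (\<sigma>' (Suc t)) p \<and> In_nbrs (\<sigma> (Suc t)) p \<subseteq> K t"
    and "p \<in> K r"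
  shows "view \<sigma> x r p = view \<sigma>' x' r p"
  using assms(2,3)
proof (induction r arbitrary: p)
  case 0
  then show ?case using assms(1) by simp
next
  case (Suc r)
  have step: "In_nbrs (\<sigma> (Suc r)) p = In_nbrs (\<sigma>' (Suc r)) p" "In_nbrs (\<sigma> (Suc r)) p \<subseteq> K r"
    using Suc.prems by blast+
  have "view \<sigma> x r q = view \<sigma>' x' r q" if "q \<in> In_nbrs (\<sigma>' (Suc r)) p" for q
  proof (rule Suc.IH)
    show "In_nbrs (\<sigma> (Suc t)) p = In_nbrs (\<sigma>' (Suc t)) p \<and> In_nbrs (\<sigma> (Suc t)) p \<subseteq> K t"
      if "t < r" "p \<in> K (Suc t)" for t p
      by (rule Suc.prems(1)) (use that in auto)
    show "q \<in> K r" using step that by auto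
  qed
  then have "view \<sigma> x r ` In_nbrs (\<sigma> (Suc r)) p = view \<sigma>' x' r ` In_nbrs (\<sigma>' (Suc r)) p"
    unfolding step by (intro image_cong) auto
  then show ?case by simp
qed

lemma finite_In_nbrs: "comm_graph n G \<Longrightarrow> finite (In_nbrs G p)"
  by (rule finite_subset[of _ "{..<n}"]) (auto simp: comm_graph_def In_nbrs_def)

text \<open>Self-loops make every process remember its own past.\<close>

lemma view_eq_earlier:
  assumes "\<And>t. t \<ge> 1 \<Longrightarrow> comm_graph n (\<sigma> t)" "\<And>t. t \<ge> 1 \<Longrightarrow> comm_graph n (\<sigma>' t)"
    and "p < n" "s \<le> r" "view \<sigma> x r p = view \<sigma>' x' r p"
  shows "view \<sigma> x s p = view \<sigma>' x' s p"
  using assms(4,5)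
proof (induction r)
  case (Suc r)
  have "p \<in> In_nbrs (\<sigma> (Suc r)) p"
    using assms(1)[of "Suc r"] \<open>p < n\<close> by (simp add: comm_graph_def In_nbrs_def)
  then have "view \<sigma> x r p = view \<sigma>' x' r p"
    using Suc.prems(2) view_Suc_eq_iff[OF finite_In_nbrs finite_In_nbrs] assms(1,2)
    by (metis le_add1 plus_1_eq_Suc)
  then show ?case using Suc by (cases "s = Suc r") auto
qed simp

lemma view_eq_In_nbrs:
  assumes "\<And>t. t \<ge> 1 \<Longrightarrow> comm_graph n (\<sigma> t)" "\<And>t. t \<ge> 1 \<Longrightarrow> comm_graph n (\<sigma>' t)"
    and "p < n" "1 \<le> s" "s \<le> r" "view \<sigma> x r p = view \<sigma>' x' r p"
  shows "In_nbrs (\<sigma> s) p = In_nbrs (\<sigma>' s) p"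
    and "q \<in> In_nbrs (\<sigma> s) p \<Longrightarrow> view \<sigma> x (s - 1) q = view \<sigma>' x' (s - 1) q"
proof -
  obtain s' where s: "s = Suc s'" using \<open>1 \<le> s\<close> by (cases s) auto
  have "view \<sigma> x s p = view \<sigma>' x' s p"
    using view_eq_earlier[of n \<sigma> \<sigma>'] assms by blast
  moreover have "finite (In_nbrs (\<sigma> (Suc s')) p)" "finite (In_nbrs (\<sigma>' (Suc s')) p)"
    by (rule finite_In_nbrs, rule assms(1), simp, rule finite_In_nbrs, rule assms(2), simp)
  ultimately have *: "In_nbrs (\<sigma> (Suc s')) p = In_nbrs (\<sigma>' (Suc s')) p \<and>
    (\<forall>q\<in>In_nbrs (\<sigma> (Suc s')) p. view \<sigma> x s' q = view \<sigma>' x' s' q)"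
    unfolding s using view_Suc_eq_iff by blast
  show "In_nbrs (\<sigma> s) p = In_nbrs (\<sigma>' s) p" using * s by simp
  show "q \<in> In_nbrs (\<sigma> s) p \<Longrightarrow> view \<sigma> x (s - 1) q = view \<sigma>' x' (s - 1) q" using * s by simp
qed


section \<open>Roots\<close>

text \<open>\<open>R\<close> is a clique that hears nobody outside. Since everyone hears directly
  from \<open>R\<close>, every root component must contain a member of \<open>R\<close>.\<close>

lemma root_components_eq:
  assumes G: "comm_graph n G"
    and R: "R \<noteq> {}" "R \<subseteq> {..<n}"
    and closed: "\<And>p. p \<in> R \<Longrightarrow> In_nbrs G p = R"
    and hear: "\<And>p. p < n \<Longrightarrow> In_nbrs G p \<inter> R \<noteq> {}"
  shows "root_components n G = {R}"
proof -
  define E where "E = {(p, q) \<in> {..<n} \<times> {..<n}. (p, q) \<in> G\<^sup>* \<and> (q, p) \<in> G\<^sup>*}"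
  have pred: "q \<in> R" if "(q, p) \<in> G\<^sup>*" "p \<in> R" for p q
    using that by (induction rule: converse_rtrancl_induct) (use closed in \<open>auto simp: In_nbrs_def\<close>)
  have cls: "E `` {p} = R" if "p \<in> R" for p
  proof
    show "E `` {p} \<subseteq> R" using pred that by (auto simp: E_def)
    show "R \<subseteq> E `` {p}"
    proof
      fix q assume "q \<in> R"
      then have "(q, p) \<in> G" "(p, q) \<in> G" using closed that by (auto simp: In_nbrs_def)
      then show "q \<in> E `` {p}" using \<open>q \<in> R\<close> that R by (auto simp: E_def)
    qed
  qed
  show ?thesis
  proof
    show "{R} \<subseteq> root_components n G"
    proof -
      obtain p where "p \<in> R" using R by blast
      then have "R \<in> {..<n} // E" using cls R by (metis quotientI subsetD)
      then show ?thesis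
        using closed by (auto simp: root_components_def strong_components_def E_def In_nbrs_def)
    qed
    show "root_components n G \<subseteq> {R}"
    proof
      fix C assume C: "C \<in> root_components n G"
      then obtain x where x: "x < n" "C = E `` {x}"
        by (auto simp: root_components_def strong_components_def E_def quotient_def)
      then have "x \<in> C" by (auto simp: E_def)
      obtain r where r: "r \<in> R" "(r, x) \<in> G" using hear x(1) by (auto simp: In_nbrs_def)
      then have "r \<in> C" using C \<open>x \<in> C\<close> by (auto simp: root_components_def)
      then have "x \<in> E `` {r}" using x by (auto simp: E_def)
      then have "x \<in> R" using cls r(1) by blast
      then show "C \<in> {R}" using cls x(2) by blast
    qed
  qed
qed

lemma
  assumes "root_components n G = {R}"
  shows rooted_if_root_components: "rooted n G" and Root_if_root_components: "Root n G = R"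
  using assms by (auto simp: rooted_def Root_def)


section \<open>The message adversary\<close>

text \<open>Four processes per index, in the order \<open>w False l\<close>,
  \<open>u False l\<close>, \<open>w True l\<close>, \<open>u True l\<close>. So
  \<open>colour\<close> is the second binary digit, which leftover processes have too, and parity
  separates \<open>w\<close> from \<open>u\<close>.\<close>

definition w :: "bool \<Rightarrow> nat \<Rightarrow> nat" where "w c l = 4 * l + 2 * of_bool c"
definition u :: "bool \<Rightarrow> nat \<Rightarrow> nat" where "u c l = Suc (w c l)"
definition colour :: "nat \<Rightarrow> bool" where "colour p = odd (p div 2)"

lemma colour_w [simp]: "colour (w c l) = c"
  by (cases c) (simp_all add: colour_def w_def)

lemma colour_u [simp]: "colour (u c l) = c"
  by (cases c) (simp_all add: colour_def u_def w_def)

lemma w_eq_w [simp]: "w c l = w c' l' \<longleftrightarrow> c = c' \<and> l = l'"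
proof
  assume eq: "w c l = w c' l'"
  then have "colour (w c l) = colour (w c' l')" by simp
  then have "c = c'" by (simp only: colour_w)
  then show "c = c' \<and> l = l'" using eq by (simp add: w_def)
qed simp

lemma u_eq_u [simp]: "u c l = u c' l' \<longleftrightarrow> c = c' \<and> l = l'"
  by (simp add: u_def)

lemma w_neq_u [simp]: "w c l \<noteq> u c' l'" "u c' l' \<noteq> w c l"
proof -
  have "even (w c l)" "odd (u c' l')" by (simp_all add: u_def w_def)
  then show "w c l \<noteq> u c' l'" "u c' l' \<noteq> w c l" by auto
qed

lemma u_less: "4 * m \<le> n \<Longrightarrow> l < m \<Longrightarrow> u c l < n"
  by (cases c) (simp_all add: u_def w_def)

lemma w_less: "4 * m \<le> n \<Longrightarrow> l < m \<Longrightarrow> w c l < n"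
  using u_less[of m n l c] by (simp add: u_def)

definition all_w :: "nat set \<Rightarrow> nat set" where
  "all_w J = {w c l | c l. l \<in> J}"

definition mid :: "nat \<Rightarrow> nat set \<Rightarrow> graph" where
  "mid n J = {(q, p). p < n \<and> q \<in> insert p (all_w J)}"

text \<open>The middle case singles out the processes of the other colour that detect the departure
  from \<open>mid\<close>. Having \<open>u c l\<close> in the root keeps roots out of edge labels;
  its index is free so that the lower bound can pick a process unaware of an earlier
  exchange.\<close>

definition side_nbrs :: "bool \<Rightarrow> nat set \<Rightarrow> nat \<Rightarrow> nat \<Rightarrow> nat set" where
  "side_nbrs c J l p =
    (if colour p = c then {p, u c l} \<union> w c ` J
     else if p \<in> u (\<not> c) ` J then {p, u c l} \<union> all_w J
     else insert p (all_w J))"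

definition side :: "nat \<Rightarrow> bool \<Rightarrow> nat set \<Rightarrow> nat \<Rightarrow> graph" where
  "side n c J l = {(q, p). p < n \<and> q \<in> side_nbrs c J l p}"

definition block :: "nat \<Rightarrow> nat set \<Rightarrow> graph set" where
  "block n J = insert (mid n J) {side n c J l | c l. l \<in> J}"

lemma block_cases [consumes 1, case_names mid side]:
  assumes "G \<in> block n J"
  obtains "G = mid n J" | c l where "l \<in> J" "G = side n c J l"
  using assms by (auto simp: block_def)

lemma mid_in_block [simp]: "mid n J \<in> block n J"
  and side_in_block [simp]: "l \<in> J \<Longrightarrow> side n c J l \<in> block n J"
  by (auto simp: block_def)

lemma In_mid [simp]: "p < n \<Longrightarrow> In_nbrs (mid n J) p = insert p (all_w J)"
  by (auto simp: In_nbrs_def mid_def)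

lemma In_side [simp]: "p < n \<Longrightarrow> In_nbrs (side n c J l) p = side_nbrs c J l p"
  by (auto simp: In_nbrs_def side_def)

lemma all_w_iff [simp]: "w c l \<in> all_w J \<longleftrightarrow> l \<in> J" "u c l \<notin> all_w J"
  by (auto simp: all_w_def)

text \<open>Whichever graph of the block is used, a process hears the \<open>w\<close> of its own
  colour with index in \<open>J\<close>; only its self-loop can blur this, whence the removal of
  \<open>p\<close>.\<close>

lemma In_block_w:
  assumes "G \<in> block n J" "p < n"
  shows "In_nbrs G p \<inter> range (w (colour p)) - {p} = w (colour p) ` J - {p}"
  using assms
proof (cases rule: block_cases)
  case mid
  then show ?thesis using assms by (auto simp: all_w_def)
next
  case (side c l)
  then show ?thesis using assms by (auto simp: all_w_def side_nbrs_def)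
qed

text \<open>The antichain serves twice: it makes blocks recognisable, and it supplies in a later
  block an index outside an earlier one.\<close>

locale adversary =
  fixes n m :: nat and \<F> :: "nat set set"
  assumes size: "4 * m \<le> n"
    and finite_family: "finite \<F>" and family_nonempty: "\<F> \<noteq> {}"
    and range_family: "J \<in> \<F> \<Longrightarrow> J \<subseteq> {..<m}"
    and member_nonempty: "J \<in> \<F> \<Longrightarrow> J \<noteq> {}"
    and antichain: "J \<in> \<F> \<Longrightarrow> J' \<in> \<F> \<Longrightarrow> J \<subseteq> J' \<Longrightarrow> J = J'"
begin

definition D :: "graph set" where "D = (\<Union>J\<in>\<F>. block n J)"

lemma u_lt: "J \<in> \<F> \<Longrightarrow> l \<in> J \<Longrightarrow> u c l < n"
  using u_less size range_family by blast

lemma w_lt: "J \<in> \<F> \<Longrightarrow> l \<in> J \<Longrightarrow> w c l < n"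
  using w_less size range_family by blast

lemma comm_graph_block:
  assumes J: "J \<in> \<F>" and G: "G \<in> block n J"
  shows "comm_graph n G"
  using G
proof (cases rule: block_cases)
  case mid
  then show ?thesis using J w_lt by (auto simp: comm_graph_def mid_def all_w_def)
next
  case (side c l)
  then show ?thesis using J w_lt u_lt
    by (auto simp: comm_graph_def side_def side_nbrs_def all_w_def split: if_splits)
qed

section \<open>Roots of the graphs in a block\<close>

lemma root_components_mid:
  assumes J: "J \<in> \<F>"
  shows "root_components n (mid n J) = {all_w J}"
proof (rule root_components_eq)
  show "comm_graph n (mid n J)" using comm_graph_block[OF J] by simp
  show ne: "all_w J \<noteq> {}" using member_nonempty[OF J] by (auto simp: all_w_def)
  show sub: "all_w J \<subseteq> {..<n}" using w_lt[OF J] by (auto simp: all_w_def)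
  show "In_nbrs (mid n J) p = all_w J" if "p \<in> all_w J" for p
    using sub that by auto
  show "In_nbrs (mid n J) p \<inter> all_w J \<noteq> {}" if "p < n" for p
    using ne that by auto
qed

lemma root_components_side:
  assumes J: "J \<in> \<F>" and l: "l \<in> J"
  shows "root_components n (side n c J l) = {insert (u c l) (w c ` J)}"
proof (rule root_components_eq)
  show "comm_graph n (side n c J l)" using comm_graph_block[OF J] l by simp
  show "insert (u c l) (w c ` J) \<noteq> {}" by simp
  show sub: "insert (u c l) (w c ` J) \<subseteq> {..<n}" using w_lt[OF J] u_lt[OF J] l by auto
  show "In_nbrs (side n c J l) p = insert (u c l) (w c ` J)"
    if "p \<in> insert (u c l) (w c ` J)" for p
  proof -
    have "colour p = c" using that by auto
    moreover have "p < n" using sub that by auto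
    ultimately show ?thesis using that by (auto simp: side_nbrs_def)
  qed
  show "In_nbrs (side n c J l) p \<inter> insert (u c l) (w c ` J) \<noteq> {}" if "p < n" for p
  proof -
    have "w c l \<in> In_nbrs (side n c J l) p" using that l by (auto simp: side_nbrs_def)
    then show ?thesis using l by auto
  qed
qed

lemma Root_mid: "J \<in> \<F> \<Longrightarrow> Root n (mid n J) = all_w J"
  by (rule Root_if_root_components[OF root_components_mid])

lemma Root_side: "J \<in> \<F> \<Longrightarrow> l \<in> J \<Longrightarrow> Root n (side n c J l) = insert (u c l) (w c ` J)"
  by (rule Root_if_root_components[OF root_components_side])

lemma rooted_block:
  assumes "J \<in> \<F>" "G \<in> block n J"
  shows "rooted n G"
  using assms(2)
proof (cases rule: block_cases)
  case mid
  then show ?thesis using rooted_if_root_components[OF root_components_mid[OF assms(1)]] by simp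
next
  case (side c l)
  then show ?thesis using rooted_if_root_components[OF root_components_side[OF assms(1)]] by simp
qed

lemma Root_block_nonempty:
  assumes "J \<in> \<F>" "G \<in> block n J"
  shows "Root n G \<noteq> {}"
  using assms(2)
proof (cases rule: block_cases)
  case mid
  then show ?thesis using member_nonempty[OF assms(1)] Root_mid[OF assms(1)] by (auto simp: all_w_def)
next
  case (side c l)
  then show ?thesis using Root_side[OF assms(1)] by auto
qed

section \<open>Recognition of blocks, edge labels and the stopping index\<close>

lemma block_id:
  assumes J: "J \<in> \<F>" "J' \<in> \<F>" and G: "G \<in> block n J" and H: "H \<in> block n J'"
    and p: "p < n" and eq: "In_nbrs G p = In_nbrs H p"
  shows "J = J'"
proof (rule ccontr)
  assume ne: "J \<noteq> J'"
  \<comment> \<open>The sets differ in both directions, and the self-loop can conceal only one of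
    the two differences.\<close>
  obtain l where l: "l \<in> J" "l \<notin> J'" using antichain J ne by blast
  obtain l' where l': "l' \<in> J'" "l' \<notin> J" using antichain J ne by blast
  let ?w = "w (colour p)"
  have eqW: "?w ` J - {p} = ?w ` J' - {p}"
    using In_block_w[OF G p] In_block_w[OF H p] eq by simp
  have "?w l \<in> ?w ` J" "?w l \<notin> ?w ` J'" "?w l' \<in> ?w ` J'" "?w l' \<notin> ?w ` J" using l l' by auto
  then have "?w l = p" "?w l' = p" using eqW by blast+
  then have "l = l'" using w_eq_w by metis
  then show False using l l' by simp
qed

text \<open>An exchange within a block is noticed by one whole colour and by the \<open>u\<close> of
  the other colour with index in \<open>J\<close>. Between side graphs of different colours it is
  noticed by everyone.\<close>

lemma edge_label_block:
  assumes J: "J \<in> \<F>" and G: "G \<in> block n J" and H: "H \<in> block n J" and ne: "G \<noteq> H"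
  obtains c where "edge_label n G H \<subseteq> {p. colour p = c} - u c ` J"
proof -
  obtain j where j: "j \<in> J" using member_nonempty J by blast
  have mid_side: "edge_label n (mid n J) (side n c J l) \<subseteq> {p. colour p = (\<not> c)} - u (\<not> c) ` J" for c l
  proof
    fix p assume "p \<in> edge_label n (mid n J) (side n c J l)"
    then have p: "p < n" and eq: "insert p (all_w J) = side_nbrs c J l p"
      by (auto simp: edge_label_def)
    have "w (\<not> c) j \<in> insert p (all_w J)" using j by simp
    then have "w (\<not> c) j \<in> side_nbrs c J l p" using eq by simp
    then have col: "colour p = (\<not> c)" by (auto simp: side_nbrs_def split: if_splits)
    have "u c l \<notin> insert p (all_w J)" using col by auto
    then have "p \<notin> u (\<not> c) ` J" using eq col by (auto simp: side_nbrs_def)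
    then show "p \<in> {p. colour p = (\<not> c)} - u (\<not> c) ` J" using col by auto
  qed
  have side_side: "edge_label n (side n c J l) (side n c J l') \<subseteq> {p. colour p = (\<not> c)} - u (\<not> c) ` J"
    if "l \<noteq> l'" for c l l'
  proof
    fix p assume "p \<in> edge_label n (side n c J l) (side n c J l')"
    then have p: "p < n" and eq: "side_nbrs c J l p = side_nbrs c J l' p"
      by (auto simp: edge_label_def)
    \<comment> \<open>A process that is itself \<open>u c l\<close> or \<open>u c l'\<close> hears
      itself in both graphs, but it cannot be both.\<close>
    have no: "\<not> (u c l \<in> side_nbrs c J l' p \<and> u c l' \<in> side_nbrs c J l p)"
      using that by (auto simp: side_nbrs_def split: if_splits)
    have "u c i \<in> side_nbrs c J i p" if "colour p = c \<or> p \<in> u (\<not> c) ` J" for i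
      using that by (auto simp: side_nbrs_def)
    then have "\<not> (colour p = c \<or> p \<in> u (\<not> c) ` J)" using no eq by metis
    then show "p \<in> {p. colour p = (\<not> c)} - u (\<not> c) ` J" by auto
  qed
  have side_other: "edge_label n (side n c J l) (side n (\<not> c) J l') = {}" for c l l'
  proof -
    have False if eq: "side_nbrs c J l p = side_nbrs (\<not> c) J l' p" and "colour p = c" for p c l l'
    proof -
      have "w (\<not> c) j \<in> side_nbrs (\<not> c) J l' p" using j \<open>colour p = c\<close> by (auto simp: side_nbrs_def)
      then have "w (\<not> c) j \<in> {p, u c l} \<union> w c ` J"
        using eq \<open>colour p = c\<close> by (simp add: side_nbrs_def)
      then show False using \<open>colour p = c\<close> by auto
    qed
    note no = this
    have False if p: "p \<in> edge_label n (side n c J l) (side n (\<not> c) J l')" for p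
    proof -
      have eq: "side_nbrs c J l p = side_nbrs (\<not> c) J l' p" using p by (auto simp: edge_label_def)
      show False
      proof (cases "colour p = c")
        case True
        then show False using no[OF eq] by simp
      next
        case False
        then show False using no[of "\<not> c" l' p l] eq by simp
      qed
    qed
    then show ?thesis by blast
  qed
  have sym: "edge_label n A B = edge_label n B A" for A B by (auto simp: edge_label_def)
  show thesis
    using G
  proof (cases rule: block_cases)
    case mid
    obtain c l where "H = side n c J l" using H ne mid by (auto simp: block_def)
    then show thesis using that[of "\<not> c"] mid mid_side by simp
  next
    case G: (side c l)
    show thesis using H
    proof (cases rule: block_cases)
      case mid
      then show thesis using that[of "\<not> c"] G mid_side sym[of G] by simp
    next
      case (side c' l')
      show thesis
      proof (cases "c' = c")
        case True
        then show thesis using that[of "\<not> c"] side G side_side[of l l' c] ne by blast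
      next
        case False
        then have "c' = (\<not> c)" by simp
        then show thesis using that[of c] side G side_other by simp
      qed
    qed
  qed
qed

text \<open>The root of \<open>mid\<close> has members of both colours, and that of a side graph
  contains some \<open>u c' l\<close> with \<open>l \<in> J\<close>, which every label
  avoids.\<close>

lemma no_root_in_edge_label:
  assumes J: "J \<in> \<F>" and G: "G \<in> block n J" and H: "H \<in> block n J" and ne: "G \<noteq> H"
    and F: "F \<in> block n J"
  shows "\<not> Root n F \<subseteq> edge_label n G H"
proof -
  obtain c where c: "edge_label n G H \<subseteq> {p. colour p = c} - u c ` J"
    by (rule edge_label_block[OF J G H ne])
  obtain q where "q \<in> Root n F" "q \<notin> {p. colour p = c} - u c ` J"
    using F
  proof (cases rule: block_cases)
    case mid
    obtain j where "j \<in> J" using member_nonempty J by blast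
    then have "w (\<not> c) j \<in> Root n F" using mid Root_mid J by auto
    then show thesis using that by auto
  next
    case (side c' l)
    have "u c' l \<in> Root n F" using side Root_side J by auto
    moreover have "u c' l \<notin> {p. colour p = c} - u c ` J" using side by auto
    ultimately show thesis using that by blast
  qed
  then show ?thesis using c by blast
qed

text \<open>Recognition confines each component to one block, where no label contains a root, so all
  edges vanish at once.\<close>

lemma refine_indist_graph: "refine n (indist_graph n D) = {}"
proof -
  have same: "\<exists>J\<in>\<F>. G \<in> block n J \<and> H \<in> block n J" if e: "(G, H) \<in> indist_graph n D" for G H
  proof -
    obtain J J' where "J \<in> \<F>" "J' \<in> \<F>" "G \<in> block n J" "H \<in> block n J'"
      using e by (auto simp: indist_graph_def D_def)
    moreover obtain p where "p < n" "In_nbrs G p = In_nbrs H p"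
      using e by (auto simp: indist_graph_def edge_label_def)
    ultimately show ?thesis using block_id by blast
  qed
  have closed: "H \<in> block n J"
    if "(G, H) \<in> (indist_graph n D)\<^sup>*" "G \<in> block n J" "J \<in> \<F>" for G H J
    using that
  proof (induction rule: rtrancl_induct)
    case (step H H')
    obtain J' where J': "J' \<in> \<F>" "H \<in> block n J'" "H' \<in> block n J'" using same step by blast
    have "edge_label n H H' \<noteq> {}" using step by (auto simp: indist_graph_def)
    then obtain p where "p < n" by (auto simp: edge_label_def)
    then have "J' = J" using block_id J' step by blast
    then show ?case using J' by simp
  qed
  show ?thesis
  proof (rule ccontr)
    assume "refine n (indist_graph n D) \<noteq> {}"
    then obtain G H F where e: "(G, H) \<in> indist_graph n D" "(G, F) \<in> (indist_graph n D)\<^sup>*"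
      "Root n F \<subseteq> edge_label n G H"
      by (auto simp: refine_def component_of_def)
    obtain J where "J \<in> \<F>" "G \<in> block n J" "H \<in> block n J" using same e by blast
    moreover from this have "F \<in> block n J" using closed e by blast
    moreover have "G \<noteq> H" using e by (auto simp: indist_graph_def)
    ultimately show False using no_root_in_edge_label e by blast
  qed
qed

text \<open>Without edges each component is a single graph with nonempty root, so compatibility
  stops the procedure at its first possible index.\<close>

lemma TD_le: "TD n D \<le> 2"
  unfolding TD_def
proof (rule Least_le, intro conjI disjI2 ballI)
  fix G assume "G \<in> D"
  then have "Root n G \<noteq> {}" using Root_block_nonempty by (auto simp: D_def)
  moreover have "component_of (iterate_graph n D 2) G = {G}"
    by (simp add: iterate_graph_def component_of_def refine_indist_graph)
  ultimately show "root_compatible n (component_of (iterate_graph n D 2) G)"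
    by (simp add: root_compatible_def)
qed simp

lemma comm_graph_D: "G \<in> D \<Longrightarrow> comm_graph n G"
  using comm_graph_block by (auto simp: D_def)

lemma rooted_D: "G \<in> D \<Longrightarrow> rooted n G"
  using rooted_block by (auto simp: D_def)

lemma oblivious_adversary_D: "oblivious_adversary n D"
proof -
  obtain J where "J \<in> \<F>" using family_nonempty by blast
  then have "mid n J \<in> D" unfolding D_def using mid_in_block by blast
  then show ?thesis using comm_graph_D by (auto simp: oblivious_adversary_def)
qed

subsection \<open>Lower bound\<close>

lemma n_pos: "u c 0 < n" "0 < n"
proof -
  obtain J where "J \<in> \<F>" using family_nonempty by blast
  then have "m > 0" using range_family member_nonempty by fastforce
  then show "u c 0 < n" by (intro u_less[OF size])
  then show "0 < n" by simp
qed

text \<open>The processes to which \<open>mid n J\<close> and \<open>side n (\<not> c) J l\<close>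
  look alike; with \<open>{}\<close> for \<open>J\<close>, the whole colour class.\<close>

definition shielded :: "bool \<Rightarrow> nat set \<Rightarrow> nat set" where
  "shielded c J = {p. p < n \<and> colour p = c} - u c ` J"

text \<open>The process \<open>u c l\<close> is itself shielded because \<open>l\<close> avoids
  \<open>I\<close>, so ignorance survives such a round.\<close>

lemma In_side_shielded:
  assumes "J \<in> \<F>" "l \<in> J" "l \<notin> I" "p \<in> shielded c I"
  shows "In_nbrs (side n c J l) p \<subseteq> shielded c I"
  using assms u_lt w_lt by (auto simp: shielded_def side_nbrs_def)

lemma In_side_eq_mid: "p \<in> shielded (\<not> c) J \<Longrightarrow> In_nbrs (side n c J l) p = In_nbrs (mid n J) p"
  by (auto simp: shielded_def side_nbrs_def)

lemma w_shielded: "J \<in> \<F> \<Longrightarrow> j \<in> J \<Longrightarrow> w c j \<in> shielded c I"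
  using w_lt by (auto simp: shielded_def)

lemma obtain_blocks:
  assumes "r \<le> card \<F>"
  obtains J :: "nat \<Rightarrow> nat set" where "range J \<subseteq> \<F>" "inj_on J {1..r}"
proof -
  have card: "card \<F> > 0" using finite_family family_nonempty by (simp add: card_gt_0_iff)
  obtain h where h: "bij_betw h {0..<card \<F>} \<F>" using ex_bij_betw_nat_finite[OF finite_family] by blast
  \<comment> \<open>Rounds start at 1, hence \<open>t - 1\<close>; the remainder assigns a block to
    every later round as well.\<close>
  define J where "J t = h ((t - 1) mod card \<F>)" for t
  have "range J \<subseteq> \<F>"
    using h card by (auto simp: J_def bij_betw_def)
  moreover have "inj_on J {1..r}"
  proof (rule inj_onI)
    fix s t assume st: "s \<in> {1..r}" "t \<in> {1..r}" "J s = J t"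
    then have "s - 1 < card \<F>" "t - 1 < card \<F>" using assms by auto
    then have "h (s - 1) = h (t - 1)" "s - 1 \<in> {0..<card \<F>}" "t - 1 \<in> {0..<card \<F>}"
      using st by (auto simp: J_def)
    then have "s - 1 = t - 1" using h by (auto simp: bij_betw_def dest: inj_onD)
    then show "s = t" using st by auto
  qed
  ultimately show thesis by (rule that)
qed

lemma undecided_run:
  fixes V :: "'v set"
  assumes V: "v \<in> V" "v' \<in> V" "v \<noteq> v'" and correct: "correct_under n V D \<Delta>" and r: "r \<le> card \<F>"
  shows "\<exists>x \<sigma> p. is_run n V D x \<sigma> \<and> p < n \<and> \<not> (\<exists>v. decided_by \<Delta> x \<sigma> p r v)"
proof (rule ccontr)
  assume neg: "\<not> ?thesis"
  obtain J where "range J \<subseteq> \<F>" and inj: "inj_on J {1..r}" by (rule obtain_blocks[OF r])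
  then have J: "J t \<in> \<F>" for t by blast
  \<comment> \<open>All these patterns share one sequence of blocks and differ only in the graph
    taken from each.\<close>
  define \<Sigma> where "\<Sigma> = {\<sigma>. \<forall>t. \<sigma> t \<in> block n (J t)}"
  define \<X> where "\<X> = {x. \<forall>p<n. x p \<in> V}"
  \<comment> \<open>If everyone has decided by round \<open>r\<close>, agreement lets process
    \<open>0\<close> speak for the whole run.\<close>
  define out where "out x \<sigma> = \<Delta> 0 (view \<sigma> x r 0)" for x \<sigma>
  have run: "is_run n V D x \<sigma>" if "x \<in> \<X>" "\<sigma> \<in> \<Sigma>" for x \<sigma>
    using that J by (auto simp: is_run_def admissible_def D_def \<X>_def \<Sigma>_def)
  have out: "\<Delta> p (view \<sigma> x r p) = out x \<sigma>" "\<exists>q<n. out x \<sigma> = Some (x q)"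
    if "x \<in> \<X>" "\<sigma> \<in> \<Sigma>" and p: "p < n" for x \<sigma> p
  proof -
    note R = run[OF that(1,2)]
    obtain a where a: "decided_by \<Delta> x \<sigma> p r a" using neg R p by blast
    obtain b where b: "decided_by \<Delta> x \<sigma> 0 r b" using neg R n_pos by blast
    have "a = b" using correct R p n_pos a b unfolding correct_under_def by blast
    then show "\<Delta> p (view \<sigma> x r p) = out x \<sigma>" using a b by (simp add: decided_by_def out_def)
    have "\<exists>q<n. b = x q" using correct R n_pos b unfolding correct_under_def by blast
    then show "\<exists>q<n. out x \<sigma> = Some (x q)" using b by (auto simp: decided_by_def out_def)
  qed
  have same: "out x \<sigma> = out x' \<sigma>'"
    if "x \<in> \<X>" "\<sigma> \<in> \<Sigma>" "x' \<in> \<X>" "\<sigma>' \<in> \<Sigma>" "p < n" "view \<sigma> x r p = view \<sigma>' x' r p" for x \<sigma> x' \<sigma>' p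
    using out(1)[OF that(1,2,5)] out(1)[OF that(3,4,5)] that(6) by simp
  \<comment> \<open>Backward induction: only the last \<open>d\<close> of the first \<open>r\<close>
    rounds may differ, and \<open>d = r\<close> lifts the restriction.\<close>
  have connected: "out x \<sigma> = out x \<sigma>'"
    if "d \<le> r" "x \<in> \<X>" "\<sigma> \<in> \<Sigma>" "\<sigma>' \<in> \<Sigma>" "\<And>t. 1 \<le> t \<Longrightarrow> t + d \<le> r \<Longrightarrow> \<sigma> t = \<sigma>' t" for d x \<sigma> \<sigma>'
    using that
  proof (induction d arbitrary: \<sigma> \<sigma>')
    case 0
    have "view \<sigma> x r 0 = view \<sigma>' x r 0"
      by (rule view_eqI[where K = "\<lambda>_. UNIV"]) (use 0 in auto)
    then show ?case by (simp add: out_def)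
  next
    case (Suc d)
    \<comment> \<open>Round \<open>s\<close> is the first that may differ, and the induction
      hypothesis frees all later ones. It thus suffices to change round \<open>s\<close> to
      \<open>mid\<close> in both patterns.\<close>
    define s where "s = r - d"
    have s: "1 \<le> s" "s \<le> r" "s + d = r" using Suc.prems(1) by (auto simp: s_def)
    have IH: "out x \<sigma> = out x \<sigma>'"
      if "\<sigma> \<in> \<Sigma>" "\<sigma>' \<in> \<Sigma>" "\<And>t. 1 \<le> t \<Longrightarrow> t \<le> s \<Longrightarrow> \<sigma> t = \<sigma>' t" for \<sigma> \<sigma>'
      by (rule Suc.IH) (use Suc.prems that s in auto)
    have to_mid: "out x \<sigma> = out x (\<sigma>(s := mid n (J s)))" if \<sigma>: "\<sigma> \<in> \<Sigma>" for \<sigma>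
    proof -
      have "\<sigma> s \<in> block n (J s)" using \<sigma> by (simp add: \<Sigma>_def)
      then show ?thesis
      proof (cases rule: block_cases)
        case mid
        then show ?thesis by (metis fun_upd_triv)
      next
        case (side c l)
        \<comment> \<open>Blocks after round \<open>s\<close> differ from \<open>J s\<close>, so the
          antichain gives an index outside it; elsewhere any member serves.\<close>
        have "\<exists>l. l \<in> J t \<and> (s < t \<and> t \<le> r \<longrightarrow> l \<notin> J s)" for t
        proof (cases "s < t \<and> t \<le> r")
          case True
          then have "J t \<noteq> J s" using inj s by (auto dest: inj_onD)
          then show ?thesis using antichain J by blast
        next
          case False
          then show ?thesis using member_nonempty J by blast
        qed
        then obtain L where L: "\<And>t. L t \<in> J t" "\<And>t. s < t \<Longrightarrow> t \<le> r \<Longrightarrow> L t \<notin> J s"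
          by metis
        \<comment> \<open>After round \<open>s\<close>, colour \<open>\<not> c\<close> hears only
          itself, through roots ignorant of the exchange in round \<open>s\<close>.\<close>
        define \<tau> where "\<tau> t = (if t \<le> s then \<sigma> t else side n (\<not> c) (J t) (L t))" for t
        have \<tau>: "\<tau> \<in> \<Sigma>" "\<tau>(s := mid n (J s)) \<in> \<Sigma>" using \<sigma> L by (auto simp: \<Sigma>_def \<tau>_def)
        obtain j where "j \<in> J s" using member_nonempty J by blast
        then have p: "w (\<not> c) j \<in> shielded (\<not> c) (J s)" using w_shielded J by blast
        \<comment> \<open>Nothing differs before round \<open>s\<close>; from then on the views of
          shielded processes still agree.\<close>
        define K where "K t = (if t < s then UNIV else shielded (\<not> c) (J s))" for t
        have "view \<tau> x r (w (\<not> c) j) = view (\<tau>(s := mid n (J s))) x r (w (\<not> c) j)"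
        proof (rule view_eqI[where K = K])
          fix t p assume t: "t < r" and p: "p \<in> K (Suc t)"
          consider "Suc t < s" | "Suc t = s" | "Suc t > s" by linarith
          then show "In_nbrs (\<tau> (Suc t)) p = In_nbrs ((\<tau>(s := mid n (J s))) (Suc t)) p \<and>
            In_nbrs (\<tau> (Suc t)) p \<subseteq> K t"
          proof cases
            case 1
            then show ?thesis by (simp add: K_def)
          next
            case 2
            then have "p \<in> shielded (\<not> c) (J s)" using p by (simp add: K_def)
            then show ?thesis using 2 side In_side_eq_mid by (auto simp: K_def \<tau>_def)
          next
            case 3
            then have "p \<in> shielded (\<not> c) (J s)" using p by (simp add: K_def)
            then have "In_nbrs (side n (\<not> c) (J (Suc t)) (L (Suc t))) p \<subseteq> shielded (\<not> c) (J s)"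
              using In_side_shielded J L 3 t by simp
            then show ?thesis using 3 by (simp add: K_def \<tau>_def)
          qed
        qed (use p s in \<open>auto simp: K_def\<close>)
        then have "out x \<tau> = out x (\<tau>(s := mid n (J s)))"
          using same[of x \<tau> x "\<tau>(s := mid n (J s))"] \<tau> Suc.prems p by (auto simp: shielded_def)
        moreover have "out x \<sigma> = out x \<tau>"
          by (rule IH) (use \<sigma> \<tau> in \<open>auto simp: \<tau>_def\<close>)
        moreover have "out x (\<tau>(s := mid n (J s))) = out x (\<sigma>(s := mid n (J s)))"
          by (rule IH) (use \<sigma> \<tau> in \<open>auto simp: \<tau>_def \<Sigma>_def\<close>)
        ultimately show ?thesis by simp
      qed
    qed
    have "out x (\<sigma>(s := mid n (J s))) = out x (\<sigma>'(s := mid n (J s)))"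
    proof (rule IH)
      show "(\<sigma>(s := mid n (J s))) t = (\<sigma>'(s := mid n (J s))) t" if "1 \<le> t" "t \<le> s" for t
        using Suc.prems(5)[of t] that s by auto
    qed (use Suc.prems in \<open>auto simp: \<Sigma>_def\<close>)
    then show ?case using to_mid Suc.prems(3,4) by simp
  qed
  have "\<exists>l. l \<in> J t" for t using member_nonempty J by blast
  then obtain L where L: "\<And>t. L t \<in> J t" by metis
  \<comment> \<open>Under \<open>\<rho> c\<close> colour \<open>c\<close> never hears the other
    colour, whose inputs stay hidden from it.\<close>
  define \<rho> where "\<rho> c t = side n c (J t) (L t)" for c t
  have \<rho>: "\<rho> c \<in> \<Sigma>" for c using L by (auto simp: \<Sigma>_def \<rho>_def)
  have hide: "out x (\<rho> c) = out x' (\<rho> c)"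
    if "x \<in> \<X>" "x' \<in> \<X>" "\<And>p. colour p = c \<Longrightarrow> x p = x' p" for x x' c
  proof -
    have p: "w c (L 0) \<in> shielded c {}" using w_shielded J L by blast
    have "view (\<rho> c) x r (w c (L 0)) = view (\<rho> c) x' r (w c (L 0))"
    proof (rule view_eqI[where K = "\<lambda>_. shielded c {}"])
      show "In_nbrs (\<rho> c (Suc t)) p = In_nbrs (\<rho> c (Suc t)) p \<and> In_nbrs (\<rho> c (Suc t)) p \<subseteq> shielded c {}"
        if "p \<in> shielded c {}" for t p
        using In_side_shielded[of "J (Suc t)" "L (Suc t)" "{}"] J L that by (simp add: \<rho>_def)
    qed (use p that(3) in \<open>auto simp: shielded_def\<close>)
    then show ?thesis using same \<rho> that p by (auto simp: shielded_def)
  qed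
  \<comment> \<open>To colour \<open>False\<close> this input looks constantly \<open>v\<close>, to
    colour \<open>True\<close> constantly \<open>v'\<close>; validity on the two constant inputs
    then clashes.\<close>
  define x\<^sub>1 where "x\<^sub>1 p = (if colour p then v' else v)" for p
  have X: "(\<lambda>_. v) \<in> \<X>" "x\<^sub>1 \<in> \<X>" "(\<lambda>_. v') \<in> \<X>" using V by (auto simp: \<X>_def x\<^sub>1_def)
  have "out (\<lambda>_. v) (\<rho> False) = out x\<^sub>1 (\<rho> False)" by (rule hide) (use X in \<open>auto simp: x\<^sub>1_def\<close>)
  also have "\<dots> = out x\<^sub>1 (\<rho> True)" by (rule connected[where d = r]) (use X \<rho> in auto)
  also have "\<dots> = out (\<lambda>_. v') (\<rho> True)" by (rule hide) (use X in \<open>auto simp: x\<^sub>1_def\<close>)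
  finally show False
    using out(2)[OF X(1) \<rho>] out(2)[OF X(3) \<rho>] n_pos V by (metis option.inject)
qed

subsection \<open>Solvability\<close>

text \<open>
  Process \<open>u True 0\<close> hears from the processes \<open>w True l\<close> with \<open>l \<in> J\<close> in all graphs of
  the block of \<open>J\<close>, and from no \<open>w False l\<close> exactly in the graphs \<open>side n True J l\<close>.
\<close>

definition block_index :: "graph \<Rightarrow> nat set" where
  "block_index G = {l. w True l \<in> In_nbrs G (u True 0)}"

definition is_right :: "graph \<Rightarrow> bool" where
  "is_right G \<longleftrightarrow> (\<forall>l. w False l \<notin> In_nbrs G (u True 0))"

text \<open>Since \<open>mid\<close> lets everyone hear all \<open>w\<close>, it can share its
  leader with the side graphs of colour \<open>False\<close>: besides the block, only
  \<open>is_right\<close> must be learnt.\<close>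

definition leader :: "graph \<Rightarrow> nat" where
  "leader G = w (is_right G) (Min (block_index G))"

lemma block_index:
  assumes "G \<in> block n J"
  shows "block_index G = J"
  using assms n_pos
  by (cases rule: block_cases) (auto simp: block_index_def side_nbrs_def)

lemma is_right_side: "l \<in> J \<Longrightarrow> is_right (side n c J l) \<longleftrightarrow> c"
  using n_pos by (auto simp: is_right_def side_nbrs_def)

lemma not_is_right_mid: "J \<in> \<F> \<Longrightarrow> \<not> is_right (mid n J)"
  using n_pos member_nonempty by (auto simp: is_right_def)

lemma leader:
  assumes J: "J \<in> \<F>" and G: "G \<in> block n J"
  shows "leader G < n" and "p < n \<Longrightarrow> leader G \<in> In_nbrs G p"
proof -
  have "finite J" using range_family[OF J] finite_subset by blast
  then have Min: "Min J \<in> J" using member_nonempty[OF J] by simp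
  then show "leader G < n" using w_lt[OF J] by (simp add: leader_def block_index[OF G])
  show "leader G \<in> In_nbrs G p" if "p < n"
    using G
  proof (cases rule: block_cases)
    case mid
    then show ?thesis using that Min by (simp add: leader_def block_index[OF mid_in_block])
  next
    case (side c l)
    then show ?thesis using that Min is_right_side[of l J c]
      by (simp add: leader_def block_index[OF side_in_block] side_nbrs_def)
  qed
qed

text \<open>Colour \<open>True\<close> notices whether \<open>w False j\<close> is missing, and
  \<open>u False i\<close> with \<open>i \<in> J\<close> notices a \<open>u True l\<close>. Among
  the processes below \<open>n\<close>, the informed ones are those outside
  \<open>shielded False J\<close>.\<close>

lemma is_right_eqI:
  assumes J: "J \<in> \<F>" and G: "G \<in> block n J" and H: "H \<in> block n J" and q: "q < n"
    and informed: "colour q \<or> q \<in> u False ` J" and eq: "In_nbrs G q = In_nbrs H q"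
  shows "is_right G = is_right H"
proof -
  obtain j where j: "j \<in> J" using member_nonempty[OF J] by blast
  have right_iff: "is_right G \<longleftrightarrow> (if colour q then w False j \<notin> In_nbrs G q else \<exists>l. u True l \<in> In_nbrs G q)"
    if "G \<in> block n J" for G
    using that
  proof (cases rule: block_cases)
    case mid
    then show ?thesis using j q informed not_is_right_mid[OF J] by auto
  next
    case (side c l)
    then show ?thesis using j q informed is_right_side[of l J c] by (auto simp: side_nbrs_def)
  qed
  show ?thesis using right_iff[OF G] right_iff[OF H] eq by simp
qed

text \<open>Some \<open>w True j\<close> or the process itself is informed, except for colour
  \<open>False\<close> in \<open>side n False J l\<close>; there the root member
  \<open>u False l\<close> helps, as \<open>l \<in> J\<close>.\<close>

lemma hears_informed:
  assumes J: "J \<in> \<F>" and G: "G \<in> block n J" and p: "p < n"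
  obtains q where "q \<in> In_nbrs G p" "colour q \<or> q \<in> u False ` J"
proof -
  obtain j where j: "j \<in> J" using member_nonempty[OF J] by blast
  have "\<exists>q\<in>In_nbrs G p. colour q \<or> q \<in> u False ` J"
    using G
  proof (cases rule: block_cases)
    case mid
    then have "w True j \<in> In_nbrs G p" using j p by simp
    then show ?thesis using colour_w by blast
  next
    case (side c l)
    show ?thesis
    proof (cases "colour p = c \<and> \<not> c")
      case True
      then have "u False l \<in> In_nbrs G p" using side p by (simp add: side_nbrs_def)
      then show ?thesis using side by blast
    next
      case False
      then have "w True j \<in> In_nbrs G p \<or> colour p \<and> p \<in> In_nbrs G p"
        using side p j by (auto simp: side_nbrs_def)
      then show ?thesis using colour_w by blast
    qed
  qed
  then show thesis using that by blast
qed

section \<open>The decision rule and why views determine it\<close>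

definition repeats :: "(nat \<Rightarrow> graph) \<Rightarrow> nat \<Rightarrow> nat \<Rightarrow> bool" where
  "repeats \<sigma> s t \<longleftrightarrow> 1 \<le> s \<and> s < t \<and> block_index (\<sigma> s) = block_index (\<sigma> t)"

definition dec_round :: "(nat \<Rightarrow> graph) \<Rightarrow> nat" where
  "dec_round \<sigma> = (LEAST t. \<exists>s. repeats \<sigma> s t)"

definition ref_round :: "(nat \<Rightarrow> graph) \<Rightarrow> nat" where
  "ref_round \<sigma> = (SOME s. repeats \<sigma> s (dec_round \<sigma>))"

text \<open>Everyone receives this leader's input in \<open>ref_round\<close>, but may learn only in
  \<open>dec_round\<close> who the leader was.\<close>

definition outcome :: "(nat \<Rightarrow> 'v) \<Rightarrow> (nat \<Rightarrow> graph) \<Rightarrow> 'v" where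
  "outcome x \<sigma> = x (leader (\<sigma> (ref_round \<sigma>)))"

lemma admissible_block:
  assumes "admissible D \<sigma>" "1 \<le> t"
  shows "block_index (\<sigma> t) \<in> \<F>" "\<sigma> t \<in> block n (block_index (\<sigma> t))"
proof -
  obtain J where "J \<in> \<F>" "\<sigma> t \<in> block n J" using assms by (auto simp: admissible_def D_def)
  then show "block_index (\<sigma> t) \<in> \<F>" "\<sigma> t \<in> block n (block_index (\<sigma> t))"
    using block_index by simp_all
qed

text \<open>By the pigeonhole principle, two of the first \<open>card \<F> + 1\<close> rounds share
  a block.\<close>

lemma repeats_ref_round:
  assumes "admissible D \<sigma>"
  shows "repeats \<sigma> (ref_round \<sigma>) (dec_round \<sigma>)"
proof -
  let ?f = "\<lambda>t. block_index (\<sigma> t)" and ?T = "{1..card \<F> + 1}"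
  have "?f ` ?T \<subseteq> \<F>" using admissible_block[OF assms] by auto
  then have "card (?f ` ?T) \<le> card \<F>" by (rule card_mono[OF finite_family])
  then have "card (?f ` ?T) < card ?T" by simp
  then have "\<not> inj_on ?f ?T" by (rule pigeonhole)
  then obtain s t where "s \<in> ?T" "t \<in> ?T" "s \<noteq> t" "?f s = ?f t" by (auto simp: inj_on_def)
  then have "repeats \<sigma> s t \<or> repeats \<sigma> t s" by (auto simp: repeats_def)
  then have "\<exists>t s. repeats \<sigma> s t" by blast
  then have "\<exists>s. repeats \<sigma> s (dec_round \<sigma>)" unfolding dec_round_def by (rule LeastI_ex)
  then show ?thesis unfolding ref_round_def by (rule someI_ex)
qed

lemma comm_graph_admissible: "admissible D \<sigma> \<Longrightarrow> t \<ge> 1 \<Longrightarrow> comm_graph n (\<sigma> t)"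
  using comm_graph_D by (auto simp: admissible_def)

text \<open>Blocks are visible to all, so both runs have the same two rounds. In
  \<open>dec_round\<close> an informed process passes on whether the graph of
  \<open>ref_round\<close> was right, which fixes the leader.\<close>

lemma view_determines_outcome:
  assumes adm: "admissible D \<sigma>" "admissible D \<sigma>'" and p: "p < n"
    and eq: "view \<sigma> x r p = view \<sigma>' x' r p" and r: "dec_round \<sigma> \<le> r"
  shows "dec_round \<sigma>' = dec_round \<sigma>" and "outcome x \<sigma> = outcome x' \<sigma>'"
proof -
  have cg: "comm_graph n (\<sigma> t)" "comm_graph n (\<sigma>' t)" if "t \<ge> 1" for t
    using adm that comm_graph_admissible by blast+
  have index: "block_index (\<sigma> t) = block_index (\<sigma>' t)" if "1 \<le> t" "t \<le> r" for t
    using block_id[OF admissible_block(1)[OF adm(1)] admissible_block(1)[OF adm(2)]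
        admissible_block(2)[OF adm(1)] admissible_block(2)[OF adm(2)] p] that
      view_eq_In_nbrs(1)[OF cg p _ _ eq] by blast
  then have rep: "repeats \<sigma> s t \<longleftrightarrow> repeats \<sigma>' s t" if "t \<le> r" for s t
    using that by (auto simp: repeats_def)
  \<comment> \<open>This bound places \<open>dec_round \<sigma>'\<close> within the first
    \<open>r\<close> rounds; only then can its repetition be carried back to
    \<open>\<sigma>\<close>.\<close>
  have le: "dec_round \<sigma>' \<le> dec_round \<sigma>"
    unfolding dec_round_def[of \<sigma>']
    by (rule Least_le) (use rep[OF r] repeats_ref_round[OF adm(1)] in blast)
  then have "repeats \<sigma> (ref_round \<sigma>') (dec_round \<sigma>')"
    using rep[of "dec_round \<sigma>'"] r repeats_ref_round[OF adm(2)] by simp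
  then have "dec_round \<sigma> \<le> dec_round \<sigma>'"
    unfolding dec_round_def[of \<sigma>] by (intro Least_le) blast
  with le show dec: "dec_round \<sigma>' = dec_round \<sigma>" by simp
  have ref: "ref_round \<sigma>' = ref_round \<sigma>"
    using rep[OF r] by (simp add: ref_round_def dec)
  define s t J where "s = ref_round \<sigma>" and "t = dec_round \<sigma>" and "J = block_index (\<sigma> s)"
  have st: "1 \<le> s" "s < t" "t \<le> r" "block_index (\<sigma> t) = J"
    using repeats_ref_round[OF adm(1)] r by (auto simp: repeats_def s_def t_def J_def)
  have J: "J \<in> \<F>" "\<sigma> s \<in> block n J" "\<sigma>' s \<in> block n J" "\<sigma> t \<in> block n J"
    using admissible_block[OF adm(1), of s] admissible_block[OF adm(2), of s]
      admissible_block[OF adm(1), of t] st index[of s] by (auto simp: J_def)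
  obtain q where q: "q \<in> In_nbrs (\<sigma> t) p" "colour q \<or> q \<in> u False ` J"
    by (rule hears_informed[OF J(1) J(4) p])
  have q_less: "q < n" using q(1) cg(1)[of t] st by (auto simp: In_nbrs_def comm_graph_def)
  have "view \<sigma> x (t - 1) q = view \<sigma>' x' (t - 1) q"
    using view_eq_In_nbrs(2)[OF cg p _ st(3) eq q(1)] st by simp
  then have "In_nbrs (\<sigma> s) q = In_nbrs (\<sigma>' s) q"
    by (rule view_eq_In_nbrs(1)[OF cg q_less st(1), rotated 3]) (use st in auto)
  then have "is_right (\<sigma> s) = is_right (\<sigma>' s)"
    by (rule is_right_eqI[OF J(1-3) q_less q(2)])
  then have lead: "leader (\<sigma>' s) = leader (\<sigma> s)"
    using index[of s] st by (simp add: leader_def)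
  have "leader (\<sigma> s) \<in> In_nbrs (\<sigma> s) p" by (rule leader(2)[OF J(1,2) p])
  then have "view \<sigma> x (s - 1) (leader (\<sigma> s)) = view \<sigma>' x' (s - 1) (leader (\<sigma> s))"
    using view_eq_In_nbrs(2)[OF cg p st(1) _ eq] st by simp
  then have "view \<sigma> x 0 (leader (\<sigma> s)) = view \<sigma>' x' 0 (leader (\<sigma> s))"
    by (rule view_eq_earlier[OF cg leader(1)[OF J(1,2)], rotated 3]) auto
  then show "outcome x \<sigma> = outcome x' \<sigma>'"
    by (simp add: outcome_def ref lead s_def[symmetric])
qed

lemma consensus_solvable_D:
  fixes V :: "'v set"
  shows "consensus_solvable n V D"
proof -
  define late where "late p v x \<sigma> r \<longleftrightarrow>
    is_run n V D x \<sigma> \<and> dec_round \<sigma> \<le> r \<and> v = view \<sigma> x r p"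
    for p v and x :: "nat \<Rightarrow> 'v" and \<sigma> r
  \<comment> \<open>One view may occur in many runs, but they all have the same outcome, so the
    choice is unambiguous.\<close>
  define \<Delta> where "\<Delta> p v =
    (if \<exists>x \<sigma> r. late p v x \<sigma> r
     then Some (SOME a. \<exists>x \<sigma> r. late p v x \<sigma> r \<and> a = outcome x \<sigma>) else None)" for p v
  have \<Delta>: "\<Delta> p (view \<sigma> x r p) = (if dec_round \<sigma> \<le> r then Some (outcome x \<sigma>) else None)"
    if run: "is_run n V D x \<sigma>" and p: "p < n" for x \<sigma> p r
  proof -
    have *: "dec_round \<sigma> \<le> r \<and> outcome x' \<sigma>' = outcome x \<sigma>"
      if late: "late p (view \<sigma> x r p) x' \<sigma>' r'" for x' \<sigma>' r'
    proof -
      have "r' = r" using late view_eq_imp_same by (fastforce simp: late_def)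
      then have "view \<sigma>' x' r p = view \<sigma> x r p" "dec_round \<sigma>' \<le> r" "admissible D \<sigma>'" "admissible D \<sigma>"
        using late run by (auto simp: late_def is_run_def)
      then show ?thesis using view_determines_outcome p by metis
    qed
    show ?thesis
    proof (cases "dec_round \<sigma> \<le> r")
      case True
      then have late: "late p (view \<sigma> x r p) x \<sigma> r" using run by (simp add: late_def)
      then have "(SOME a. \<exists>x' \<sigma>' r'. late p (view \<sigma> x r p) x' \<sigma>' r' \<and> a = outcome x' \<sigma>') = outcome x \<sigma>"
        by (intro some_equality) (use * in blast)+
      then show ?thesis using True late unfolding \<Delta>_def by auto
    next
      case False
      then show ?thesis using * unfolding \<Delta>_def by auto
    qed
  qed
  have lead: "leader (\<sigma> (ref_round \<sigma>)) < n" if "is_run n V D x \<sigma>" for \<sigma> and x :: "nat \<Rightarrow> 'v"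
  proof -
    have adm: "admissible D \<sigma>" using that by (simp add: is_run_def)
    then have "1 \<le> ref_round \<sigma>" using repeats_ref_round by (auto simp: repeats_def)
    then show ?thesis using leader(1) admissible_block[OF adm] by blast
  qed
  have "correct_under n V D \<Delta>"
    unfolding correct_under_def consensus_algorithm_def decided_by_def
  proof (intro conjI allI impI)
    fix x \<sigma> p r assume run: "is_run n V D x \<sigma>" and p: "p < n"
    have "outcome x \<sigma> \<in> V" using lead[OF run] run by (simp add: outcome_def is_run_def)
    then show "\<Delta> p (view \<sigma> x r p) \<in> insert None (Some ` V)" using \<Delta>[OF run p] by simp
  next
    fix x \<sigma> p r r' assume "is_run n V D x \<sigma>" "p < n" "\<Delta> p (view \<sigma> x r p) \<noteq> None" "r \<le> r'"
    then show "\<Delta> p (view \<sigma> x r' p) = \<Delta> p (view \<sigma> x r p)"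
      using \<Delta> by (auto split: if_splits)
  next
    fix x \<sigma> p assume "is_run n V D x \<sigma>" "p < n"
    then show "\<exists>r v. \<Delta> p (view \<sigma> x r p) = Some v" using \<Delta> by (metis order_refl)
  next
    fix x \<sigma> p q r s a b assume "is_run n V D x \<sigma>" "p < n" "q < n"
      "\<Delta> p (view \<sigma> x r p) = Some a" "\<Delta> q (view \<sigma> x s q) = Some b"
    then show "a = b" using \<Delta> by (auto split: if_splits)
  next
    fix x \<sigma> p r a assume "is_run n V D x \<sigma>" "p < n" "\<Delta> p (view \<sigma> x r p) = Some a"
    then have "a = x (leader (\<sigma> (ref_round \<sigma>)))" "leader (\<sigma> (ref_round \<sigma>)) < n"
      using \<Delta> lead by (auto simp: outcome_def split: if_splits)
    then show "\<exists>q<n. a = x q" by blast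
  qed
  then show ?thesis unfolding consensus_solvable_def by blast
qed

end


section \<open>An exponential antichain\<close>

text \<open>Exactly one element of each pair \<open>2 * l\<close>, \<open>2 * l + 1\<close> is
  taken. All these sets have \<open>k\<close> elements, so none properly contains another.\<close>

definition code :: "nat \<Rightarrow> nat set \<Rightarrow> nat set" where
  "code k I = {2 * l + of_bool (l \<in> I) | l. l < k}"

lemma code_iff:
  "2 * l \<in> code k I \<longleftrightarrow> l < k \<and> l \<notin> I"
  "Suc (2 * l) \<in> code k I \<longleftrightarrow> l < k \<and> l \<in> I"
proof -
  have "2 * l = 2 * l' + of_bool P \<longleftrightarrow> l' = l \<and> \<not> P"
    "Suc (2 * l) = 2 * l' + of_bool P \<longleftrightarrow> l' = l \<and> P" for l' P
    by (cases P; simp; presburger)+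
  then show "2 * l \<in> code k I \<longleftrightarrow> l < k \<and> l \<notin> I" "Suc (2 * l) \<in> code k I \<longleftrightarrow> l < k \<and> l \<in> I"
    by (auto simp: code_def)
qed

lemma code_antichain:
  assumes "I \<subseteq> {..<k}" "I' \<subseteq> {..<k}" "code k I \<subseteq> code k I'"
  shows "I = I'"
proof (rule set_eqI)
  fix l
  show "l \<in> I \<longleftrightarrow> l \<in> I'"
  proof (cases "l < k")
    case True
    then show ?thesis using subsetD[OF assms(3), of "2 * l"] subsetD[OF assms(3), of "Suc (2 * l)"]
      by (auto simp: code_iff)
  next
    case False
    then show ?thesis using assms(1,2) by auto
  qed
qed

lemma card_code: "card (code k ` Pow {..<k}) = 2 ^ k"
proof -
  have "inj_on (code k) (Pow {..<k})" using code_antichain by (auto intro!: inj_onI)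
  then show ?thesis by (simp add: card_image card_Pow)
qed

lemma adversary_code:
  assumes "1 \<le> k" "8 * k \<le> n"
  shows "adversary n (2 * k) (code k ` Pow {..<k})"
proof
  show "J = J'" if "J \<in> code k ` Pow {..<k}" "J' \<in> code k ` Pow {..<k}" "J \<subseteq> J'" for J J'
    using that code_antichain by blast
  show "J \<noteq> {}" if "J \<in> code k ` Pow {..<k}" for J
    using that assms(1) by (auto simp: code_def dest: spec[of _ 0])
  show "J \<subseteq> {..<2 * k}" if "J \<in> code k ` Pow {..<k}" for J
    using that by (auto simp: code_def)
qed (use assms in auto)

theorem theorem5:
  fixes V :: "'v set"
  assumes "finite V" and "card V \<ge> 2"
  shows "\<exists>(a::real) (K::nat) (n\<^sub>0::nat). a > 1 \<and>
    (\<forall>n\<ge>n\<^sub>0. \<exists>D :: graph set.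
       oblivious_adversary n D \<and>
       (\<forall>G\<in>D. rooted n G) \<and>
       TD n D \<le> K \<and>
       consensus_solvable n V D \<and>
       (\<forall>\<Delta>. correct_under n V D \<Delta> \<longrightarrow>
          (\<exists>x \<sigma> p. is_run n V D x \<sigma> \<and> p < n \<and>
             \<not> (\<exists>v. decided_by \<Delta> x \<sigma> p (nat \<lfloor>a ^ n\<rfloor>) v))))"
proof -
  obtain v v' where V: "v \<in> V" "v' \<in> V" "v \<noteq> v'"
    using assms card_le_Suc0_iff_eq[of V] by fastforce
  define a :: real where "a = 2 powr (1 / 16)"
  have "a > 1" by (simp add: a_def)
  moreover have "\<exists>D. oblivious_adversary n D \<and> (\<forall>G\<in>D. rooted n G) \<and> TD n D \<le> 2 \<and>
      consensus_solvable n V D \<and>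
      (\<forall>\<Delta>. correct_under n V D \<Delta> \<longrightarrow>
        (\<exists>x \<sigma> p. is_run n V D x \<sigma> \<and> p < n \<and> \<not> (\<exists>v. decided_by \<Delta> x \<sigma> p (nat \<lfloor>a ^ n\<rfloor>) v)))"
    if n: "n \<ge> 16" for n
  proof -
    \<comment> \<open>Indices range below \<open>2 * k\<close> and each needs four
      processes.\<close>
    define k where "k = n div 8"
    interpret adversary n "2 * k" "code k ` Pow {..<k}"
      by (rule adversary_code) (use n in \<open>auto simp: k_def\<close>)
    \<comment> \<open>Halving the rate \<open>1 / 8\<close> to \<open>1 / 16\<close> in the exponent
      of \<open>a\<close> absorbs the rounding in \<open>n div 8\<close> once
      \<open>n \<ge> 16\<close>.\<close>
    have "real n / 16 \<le> real k" using n unfolding k_def by linarith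
    then have "a ^ n \<le> 2 ^ k"
      by (simp add: a_def powr_powr flip: powr_realpow)
    then have "\<lfloor>a ^ n\<rfloor> \<le> 2 ^ k" by (simp add: floor_le_iff)
    then have "nat \<lfloor>a ^ n\<rfloor> \<le> 2 ^ k" by (simp add: nat_le_iff)
    then have "nat \<lfloor>a ^ n\<rfloor> \<le> card (code k ` Pow {..<k})" by (simp only: card_code)
    then show ?thesis
      using oblivious_adversary_D rooted_D TD_le consensus_solvable_D undecided_run[OF V] by blast
  qed
  ultimately show ?thesis by blast
qed

end
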